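(* Let $G$ be a graph on $n$ vertices and let $P=(A,B)$ be a $CI$-matching of $G$. Then $$2a_P+b_P\le c_G(\mathfrak m)\le 2n-b_P.$$
   Context: Let $G$ be a finite simple graph on the vertex set $[n]=\{1,\dots,n\}$, let $K$ be a field, $S=K[x_1,\dots,x_n,y_1,\dots,y_n]$ and $\mathfrak m=(x_1,\dots,x_n,y_1,\dots,y_n)$. The binomial edge ideal of $G$ is $J_G=(x_iy_j-x_jy_i : \{i,j\}\in E(G))\subset S$. For a positive integer $k$ put $\mathfrak m^{[k]}=(x_1^k,\dots,x_n^k,y_1^k,\dots,y_n^k)$, $(\mathfrak m^{[k]},J_G)=\mathfrak m^{[k]}+J_G$, $v_G(k)=\max\{r\in\mathbb N : \mathfrak m^r\not\subseteq(\mathfrak m^{[k]},J_G)\}$, and $c_G(\mathfrak m)=\lim_{k\to\infty} v_G(k)/k$ (the diagonal $F$-threshold of $S/J_G$). A $CI$-matching of $G$ is a pair $P=(A,B)$ where $A$ is an independent set of vertices of $G$ and $B$ is a set of pairwise vertex-disjoint cliques of $G$, each with at least $2$ vertices, such that if $i\in A$ and $j\in V(B):=\bigcup_{C\in B}V(C)$ then $\{i,j\}\notin E(G)$ (in particular $A$ and $V(B)$ are disjoint); either $A$ or $B$ may be empty. Put $a_P=|A|$ and $b_P=|V(B)|$. *)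

theory Defs
  imports "HOL-Analysis.Analysis" "HOL-Library.Poly_Mapping" "HOL-Library.Disjoint_Sets"
begin

text \<open>
  The vertex set is a finite type \<open>'v\<close>, so that \<open>n = CARD('v)\<close>; a graph is given by its
  set of edges, each edge being a two-element set of vertices.
\<close>

definition simple_graph :: "'v set set \<Rightarrow> bool" where
  "simple_graph E \<longleftrightarrow> (\<forall>e\<in>E. card e = 2)"

definition independent_set :: "'v set set \<Rightarrow> 'v set \<Rightarrow> bool" where
  "independent_set E A \<longleftrightarrow> (\<forall>i\<in>A. \<forall>j\<in>A. {i, j} \<notin> E)"

definition clique :: "'v set set \<Rightarrow> 'v set \<Rightarrow> bool" where
  "clique E C \<longleftrightarrow> (\<forall>i\<in>C. \<forall>j\<in>C. i \<noteq> j \<longrightarrow> {i, j} \<in> E)"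

text \<open>
  Cliques are identified with their vertex sets, so \<open>V(B)\<close> is \<open>\<Union>B\<close>.
\<close>

definition CI_matching :: "'v set set \<Rightarrow> 'v set \<Rightarrow> 'v set set \<Rightarrow> bool" where
  "CI_matching E A B \<longleftrightarrow>
     independent_set E A \<and>
     (\<forall>C\<in>B. clique E C \<and> card C \<ge> 2) \<and>
     disjoint B \<and>
     (\<forall>i\<in>A. \<forall>j\<in>\<Union>B. {i, j} \<notin> E)"

text \<open>
  The polynomial ring \<open>S\<close>: monomials are finitely supported exponent functions on the
  set of variables \<open>'v + 'v\<close>, where \<open>Inl i\<close> stands for \<open>x\<^sub>i\<close> and \<open>Inr i\<close> for \<open>y\<^sub>i\<close>.
\<close>

type_synonym ('v, 'k) xy_poly = "(('v + 'v) \<Rightarrow>\<^sub>0 nat) \<Rightarrow>\<^sub>0 'k"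

definition var_x :: "'v \<Rightarrow> ('v, 'k::field) xy_poly" where
  "var_x i = Poly_Mapping.single (Poly_Mapping.single (Inl i) 1) 1"

definition var_y :: "'v \<Rightarrow> ('v, 'k::field) xy_poly" where
  "var_y i = Poly_Mapping.single (Poly_Mapping.single (Inr i) 1) 1"

text \<open>
  A commutative ring is a module over itself, and its submodules are the ideals.
\<close>

lemma module_mult_self: "module ((*) :: 'a::comm_ring_1 \<Rightarrow> 'a \<Rightarrow> 'a)"
  by unfold_locales (simp_all add: algebra_simps)

definition ideal_gen :: "'a::comm_ring_1 set \<Rightarrow> 'a set" where
  "ideal_gen = module.span (*)"

definition ideal_sum :: "'a::comm_ring_1 set \<Rightarrow> 'a set \<Rightarrow> 'a set" where
  "ideal_sum I J = {a + b |a b. a \<in> I \<and> b \<in> J}"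

definition ideal_mult :: "'a::comm_ring_1 set \<Rightarrow> 'a set \<Rightarrow> 'a set" where
  "ideal_mult I J = ideal_gen {a * b |a b. a \<in> I \<and> b \<in> J}"

primrec ideal_power :: "'a::comm_ring_1 set \<Rightarrow> nat \<Rightarrow> 'a set" where
  "ideal_power I 0 = UNIV"
| "ideal_power I (Suc r) = ideal_mult I (ideal_power I r)"

definition max_ideal :: "('v, 'k::field) xy_poly set" where
  "max_ideal = ideal_gen (range var_x \<union> range var_y)"

definition bracket_power :: "nat \<Rightarrow> ('v, 'k::field) xy_poly set" where
  "bracket_power k = ideal_gen (range (\<lambda>i. var_x i ^ k) \<union> range (\<lambda>i. var_y i ^ k))"

definition binomial_edge_ideal :: "'v set set \<Rightarrow> ('v, 'k::field) xy_poly set" where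
  "binomial_edge_ideal E =
     ideal_gen {var_x i * var_y j - var_x j * var_y i |i j. {i, j} \<in> E}"

text \<open>
  The maximum below exists for every \<open>k \<ge> 1\<close>. For \<open>k = 0\<close> the value is immaterial.
\<close>

definition v_func :: "'k::field itself \<Rightarrow> 'v set set \<Rightarrow> nat \<Rightarrow> nat" where
  "v_func _ E k =
     Max {r. \<not> ideal_power (max_ideal :: ('v, 'k) xy_poly set) r
              \<subseteq> ideal_sum (bracket_power k) (binomial_edge_ideal E)}"

definition F_threshold :: "'k::field itself \<Rightarrow> 'v set set \<Rightarrow> real" where
  "F_threshold K E = lim (\<lambda>k. real (v_func K E k) / real k)"

end

theory Submission
  imports Defs
begin

text \<open>
  As \<open>J\<^sub>G\<close> is generated by differences of monomials, a monomial \<open>u\<close> avoids \<open>\<mm>\<^sup>[\<^sup>k\<^sup>] + J\<^sub>G\<close> iff no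
  monomial obtained from it by swapping \<open>x\<^sub>i y\<^sub>j\<close> with \<open>x\<^sub>j y\<^sub>i\<close> along edges has an exponent
  \<open>\<ge> k\<close>. Swaps preserve the degree at each vertex, hence the set \<open>T\<close> of vertices where \<open>u\<close> has
  positive degree, and inside a component of \<open>G[T]\<close> they can gather all variables of one kind
  at a single vertex, up to the degree there. So a component with \<open>s\<close> vertices contributes at
  most \<open>(k - 1) max(s, 2)\<close> to the degree of \<open>u\<close>, and this is attained. Therefore
  \<open>v\<^sub>G(k) = (k - 1) max\<^sub>T (|T| + iso(G[T]))\<close>, where \<open>iso\<close> counts isolated vertices, and \<open>c\<^sub>G(\<mm>)\<close>
  is this maximum. The lower bound is the choice \<open>T = A \<union> V(B)\<close>. For the upper bound, a clique
  \<open>C\<close> of \<open>B\<close> contributes at most \<open>|C|\<close> to \<open>|T| + iso(G[T])\<close>, and any other vertex at most 2.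
\<close>

declare One_nat_def [simp del]

section \<open>Ideals\<close>

lemma ideal_gen_base: "x \<in> S \<Longrightarrow> x \<in> ideal_gen S"
  unfolding ideal_gen_def by (rule module.span_base[OF module_mult_self])

lemma subspace_ideal_gen: "module.subspace (*) (ideal_gen S)"
  unfolding ideal_gen_def by (rule module.subspace_span[OF module_mult_self])

lemma ideal_gen_least: "S \<subseteq> I \<Longrightarrow> module.subspace (*) I \<Longrightarrow> ideal_gen S \<subseteq> I"
  unfolding ideal_gen_def by (rule module.span_minimal[OF module_mult_self])

lemma subspace_self_iff:
  "module.subspace (*) I \<longleftrightarrow>
     (0::'a::comm_ring_1) \<in> I \<and> (\<forall>x\<in>I. \<forall>y\<in>I. x + y \<in> I) \<and> (\<forall>c. \<forall>x\<in>I. c * x \<in> I)"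
  by (rule module.subspace_def[OF module_mult_self])

lemma subspace_ideal_sum:
  assumes "module.subspace (*) I" and "module.subspace (*) J"
  shows "module.subspace (*) (ideal_sum I J)"
  unfolding subspace_self_iff
proof (intro conjI ballI allI)
  show "0 \<in> ideal_sum I J"
    using assms unfolding subspace_self_iff ideal_sum_def by (force intro: exI[of _ 0])
next
  fix x y assume "x \<in> ideal_sum I J" "y \<in> ideal_sum I J"
  then obtain a b c d where "x = a + b" "y = c + d" "a \<in> I" "c \<in> I" "b \<in> J" "d \<in> J"
    unfolding ideal_sum_def by blast
  moreover from this have "x + y = (a + c) + (b + d)" by simp
  ultimately show "x + y \<in> ideal_sum I J"
    using assms unfolding subspace_self_iff ideal_sum_def by blast
next
  fix c x assume "x \<in> ideal_sum I J"
  then obtain a b where "x = a + b" "a \<in> I" "b \<in> J" unfolding ideal_sum_def by blast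
  moreover from this have "c * x = c * a + c * b" by (simp add: algebra_simps)
  ultimately show "c * x \<in> ideal_sum I J"
    using assms unfolding subspace_self_iff ideal_sum_def by blast
qed

lemma ideal_sum_left: "module.subspace (*) J \<Longrightarrow> a \<in> I \<Longrightarrow> a \<in> ideal_sum I J"
  unfolding subspace_self_iff ideal_sum_def by force

lemma ideal_sum_right: "module.subspace (*) I \<Longrightarrow> b \<in> J \<Longrightarrow> b \<in> ideal_sum I J"
  unfolding subspace_self_iff ideal_sum_def by force

lemma ideal_sum_least:
  "module.subspace (*) Q \<Longrightarrow> I \<subseteq> Q \<Longrightarrow> J \<subseteq> Q \<Longrightarrow> ideal_sum I J \<subseteq> Q"
  unfolding subspace_self_iff ideal_sum_def by blast

lemma ideal_mult_mem: "a \<in> I \<Longrightarrow> b \<in> J \<Longrightarrow> a * b \<in> ideal_mult I J"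
  unfolding ideal_mult_def by (rule ideal_gen_base) blast

section \<open>Monomials\<close>

abbreviation lookup :: "('a \<Rightarrow>\<^sub>0 'b::zero) \<Rightarrow> 'a \<Rightarrow> 'b" where
  "lookup \<equiv> Poly_Mapping.lookup"

abbreviation keys :: "('a \<Rightarrow>\<^sub>0 'b::zero) \<Rightarrow> 'a set" where
  "keys \<equiv> Poly_Mapping.keys"

abbreviation monom1 :: "('z \<Rightarrow>\<^sub>0 nat) \<Rightarrow> (('z \<Rightarrow>\<^sub>0 nat) \<Rightarrow>\<^sub>0 'k::field)" where
  "monom1 m \<equiv> Poly_Mapping.single m 1"

abbreviation unit_exp :: "'z \<Rightarrow> ('z \<Rightarrow>\<^sub>0 nat)" where
  "unit_exp z \<equiv> Poly_Mapping.single z 1"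

text \<open>Swapping x_i y_j with x_j y_i preserves the degree at every vertex, while single
  exponents may change.\<close>

definition vdeg :: "('v + 'v \<Rightarrow>\<^sub>0 nat) \<Rightarrow> 'v \<Rightarrow> nat" where
  "vdeg m i = lookup m (Inl i) + lookup m (Inr i)"

definition mdeg :: "('v::finite + 'v \<Rightarrow>\<^sub>0 nat) \<Rightarrow> nat" where
  "mdeg m = (\<Sum>i\<in>UNIV. vdeg m i)"

definition vsupp :: "('v + 'v \<Rightarrow>\<^sub>0 nat) \<Rightarrow> 'v set" where
  "vsupp m = {i. 0 < vdeg m i}"

lemma mdeg_add: "mdeg (m + m') = mdeg m + mdeg m'"
  unfolding mdeg_def vdeg_def by (simp add: lookup_add sum.distrib algebra_simps)

lemma mdeg_unit_exp: "mdeg (unit_exp z) = 1"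
  unfolding mdeg_def vdeg_def
  by (cases z) (simp_all add: lookup_single when_def sum.distrib)

lemma var_x_power: "var_x i ^ k = (monom1 (Poly_Mapping.single (Inl i) k) :: ('v, 'k::field) xy_poly)"
  by (induction k) (simp_all add: var_x_def mult_single single_add[symmetric] plus_1_eq_Suc)

lemma var_y_power: "var_y i ^ k = (monom1 (Poly_Mapping.single (Inr i) k) :: ('v, 'k::field) xy_poly)"
  by (induction k) (simp_all add: var_y_def mult_single single_add[symmetric] plus_1_eq_Suc)

lemma exp_split:
  fixes m :: "'z \<Rightarrow>\<^sub>0 nat"
  assumes "c \<le> lookup m z"
  obtains m' where "m = m' + Poly_Mapping.single z c"
proof
  show "m = (m - Poly_Mapping.single z c) + Poly_Mapping.single z c"
    by (rule poly_mapping_eqI) (use assms in \<open>auto simp: lookup_add lookup_minus lookup_single when_def\<close>)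
qed

lemma monom1_in_max_ideal: "monom1 (unit_exp z) \<in> (max_ideal :: ('v, 'k::field) xy_poly set)"
  unfolding max_ideal_def var_x_def var_y_def
  by (rule ideal_gen_base) (cases z; auto)

text \<open>With the bound \<open>max_ideal_power_mdeg\<close> it turns questions about powers of
  the ideal into questions about degrees of monomials.\<close>

lemma monom1_in_max_ideal_power:
  "monom1 m \<in> ideal_power (max_ideal :: ('v::finite, 'k::field) xy_poly set) (mdeg m)"
proof (induction "mdeg m" arbitrary: m)
  case 0
  then show ?case by simp
next
  case (Suc r)
  have "\<exists>z. 0 < lookup m z"
  proof (rule ccontr)
    assume "\<not> ?thesis"
    then have "mdeg m = 0" unfolding mdeg_def vdeg_def by simp
    with Suc show False by simp
  qed
  then obtain z where "0 < lookup m z" by blast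
  then have "1 \<le> lookup m z" by simp
  then obtain m' where m: "m = m' + unit_exp z" by (rule exp_split)
  with Suc have r: "r = mdeg m'" by (simp add: mdeg_add mdeg_unit_exp)
  have "monom1 m = (monom1 (unit_exp z) * monom1 m' :: ('v, 'k) xy_poly)"
    by (simp add: m mult_single add.commute)
  also have "\<dots> \<in> ideal_mult max_ideal (ideal_power max_ideal r)"
    using Suc(1)[OF r] r by (intro ideal_mult_mem monom1_in_max_ideal) simp
  also have "\<dots> = ideal_power max_ideal (mdeg m)" using Suc(2) by (simp flip: Suc(2))
  finally show ?case .
qed

lemma subspace_mdeg_ge:
  "module.subspace (*) {p :: ('v::finite, 'k::field) xy_poly. \<forall>m\<in>keys p. r \<le> mdeg m}"
  unfolding subspace_self_iff
proof (intro conjI ballI allI; clarsimp)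
  fix x y :: "('v, 'k) xy_poly" and m
  assume "\<forall>m\<in>keys x. r \<le> mdeg m" "\<forall>m\<in>keys y. r \<le> mdeg m" "m \<in> keys (x + y)"
  then show "r \<le> mdeg m" using Poly_Mapping.keys_add[of x y] by blast
next
  fix c x :: "('v, 'k) xy_poly" and m
  assume "\<forall>m\<in>keys x. r \<le> mdeg m" "m \<in> keys (c * x)"
  then show "r \<le> mdeg m" using keys_mult[of c x] by (force simp: mdeg_add)
qed

lemma max_ideal_power_mdeg:
  "ideal_power max_ideal r \<subseteq> {p :: ('v::finite, 'k::field) xy_poly. \<forall>m\<in>keys p. r \<le> mdeg m}"
proof (induction r)
  case 0
  then show ?case by simp
next
  case (Suc r)
  have max: "max_ideal \<subseteq> {p :: ('v, 'k) xy_poly. \<forall>m\<in>keys p. 1 \<le> mdeg m}"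
    unfolding max_ideal_def
    by (rule ideal_gen_least[OF _ subspace_mdeg_ge]) (auto simp: var_x_def var_y_def mdeg_unit_exp)
  show ?case unfolding ideal_power.simps ideal_mult_def
  proof (rule ideal_gen_least[OF _ subspace_mdeg_ge], clarsimp)
    fix a b :: "('v, 'k) xy_poly" and m
    assume a: "a \<in> max_ideal" and b: "b \<in> ideal_power max_ideal r" and m: "m \<in> keys (a * b)"
    obtain u v where "m = u + v" "u \<in> keys a" "v \<in> keys b" using m keys_mult[of a b] by blast
    moreover from this have "1 \<le> mdeg u" "r \<le> mdeg v" using max a Suc b by blast+
    ultimately show "Suc r \<le> mdeg m" by (simp add: mdeg_add)
  qed
qed

lemma sum_single_lookup: "(\<Sum>m\<in>keys p. Poly_Mapping.single m (lookup p m)) = p"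
proof (rule poly_mapping_eqI)
  fix z
  have "lookup (\<Sum>m\<in>keys p. Poly_Mapping.single m (lookup p m)) z
      = (\<Sum>m\<in>keys p. if z = m then lookup p m else 0)"
    unfolding lookup_sum lookup_single when_def by (rule sum.cong) auto
  also have "\<dots> = lookup p z" by (simp add: in_keys_iff)
  finally show "lookup (\<Sum>m\<in>keys p. Poly_Mapping.single m (lookup p m)) z = lookup p z" .
qed

lemma poly_in_ideal_if_monomials:
  fixes p :: "('z \<Rightarrow>\<^sub>0 nat) \<Rightarrow>\<^sub>0 'k::field"
  assumes Q: "module.subspace (*) Q" and "\<And>m. m \<in> keys p \<Longrightarrow> monom1 m \<in> Q"
  shows "p \<in> Q"
proof -
  have "(\<Sum>m\<in>keys p. Poly_Mapping.single 0 (lookup p m) * monom1 m) \<in> Q"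
    using assms unfolding subspace_self_iff
    by (intro module.subspace_sum[OF module_mult_self Q]) blast
  then show ?thesis by (simp add: mult_single sum_single_lookup)
qed

section \<open>Swaps of the two kinds of variables along edges\<close>

text \<open>
  Modulo \<open>J\<^sub>G\<close> the monomials \<open>m x\<^sub>i y\<^sub>j\<close> and \<open>m x\<^sub>j y\<^sub>i\<close> agree for every edge \<open>{i, j}\<close>.
\<close>

definition swap_closed :: "'v set set \<Rightarrow> ('v + 'v \<Rightarrow>\<^sub>0 nat) set \<Rightarrow> bool" where
  "swap_closed E N \<longleftrightarrow> (\<forall>m i j. {i, j} \<in> E \<longrightarrow>
     m + unit_exp (Inl i) + unit_exp (Inr j) \<in> N \<longrightarrow>
     m + unit_exp (Inl j) + unit_exp (Inr i) \<in> N)"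

definition isolated :: "'v set set \<Rightarrow> 'v set \<Rightarrow> 'v set" where
  "isolated E T = {i\<in>T. \<forall>j\<in>T. {i, j} \<notin> E}"

definition weight :: "'v set set \<Rightarrow> 'v set \<Rightarrow> nat" where
  "weight E T = card T + card (isolated E T)"

abbreviation step_in :: "'v set set \<Rightarrow> 'v set \<Rightarrow> 'v \<Rightarrow> 'v \<Rightarrow> bool" where
  "step_in E T i j \<equiv> {i, j} \<in> E \<and> i \<in> T \<and> j \<in> T"

text \<open>
  The pair \<open>(P, Q)\<close> is either \<open>(Inl, Inr)\<close> or \<open>(Inr, Inl)\<close>, so that statements about the
  \<open>x\<close>-variables and about the \<open>y\<close>-variables need to be proved only once.
\<close>

definition sides :: "('v \<Rightarrow> 'v + 'v) \<Rightarrow> ('v \<Rightarrow> 'v + 'v) \<Rightarrow> bool" where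
  "sides P Q \<longleftrightarrow> P = Inl \<and> Q = Inr \<or> P = Inr \<and> Q = Inl"

lemma vdeg_sides: "sides P Q \<Longrightarrow> vdeg m i = lookup m (P i) + lookup m (Q i)"
  by (auto simp: sides_def vdeg_def)

lemma lookup_sides:
  assumes "sides P Q"
  shows "lookup (m + unit_exp (P a) + unit_exp (Q b)) (P i) = lookup m (P i) + of_bool (i = a)"
    and "lookup (m + unit_exp (P a) + unit_exp (Q b)) (Q i) = lookup m (Q i) + of_bool (i = b)"
  using assms by (auto simp: sides_def lookup_add lookup_single when_def)

lemma vsupp_sides:
  assumes "sides P Q"
  shows "vsupp (m + unit_exp (P a) + unit_exp (Q b)) = vsupp m \<union> {a, b}"
  by (auto simp: vsupp_def vdeg_sides[OF assms] lookup_sides[OF assms])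

lemma swap_closedD:
  assumes "swap_closed E N" "sides P Q" "{i, j} \<in> E"
    "m + unit_exp (P i) + unit_exp (Q j) \<in> N"
  shows "m + unit_exp (P j) + unit_exp (Q i) \<in> N"
proof -
  have "{j, i} \<in> E" using assms(3) by (simp add: insert_commute)
  moreover have "m + unit_exp a + unit_exp b = m + unit_exp b + unit_exp a" for a b :: "'a + 'a"
    by (simp add: ac_simps)
  ultimately show ?thesis
    using assms unfolding swap_closed_def sides_def by (elim disjE conjE) simp_all
qed

text \<open>
  If the next vertex \<open>j'\<close> on the path carries a variable of kind \<open>Q\<close>, swap along the first edge
  and then along the rest of the path; otherwise it carries one of kind \<open>P\<close>, which is moved
  along the rest of the path first.
\<close>

lemma swap_along_path:
  assumes "swap_closed E N" "sides P Q"
    and "(step_in E T)\<^sup>*\<^sup>* j i"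
    and "T \<subseteq> vsupp (m + unit_exp (P j) + unit_exp (Q i))"
    and "m + unit_exp (P j) + unit_exp (Q i) \<in> N"
  shows "m + unit_exp (P i) + unit_exp (Q j) \<in> N"
  using assms(3-5)
proof (induction arbitrary: m rule: converse_rtranclp_induct)
  case base
  then show ?case by simp
next
  case (step j j')
  note swap = swap_closedD[OF assms(1,2)]
  have edge: "{j, j'} \<in> E" and j': "j' \<in> T" using step.hyps by auto
  \<comment> \<open>\<open>E\<close> may contain one-element edges in this lemma, hence the case
    \<open>j' = j\<close>.\<close>
  consider "j = i" | "j' = i" | "j' = j" | "j \<noteq> i" "j' \<noteq> i" "j' \<noteq> j" by blast
  then show ?case
  proof cases
    case 1
    then show ?thesis using step.prems by simp
  next
    case 2
    then show ?thesis using swap[OF edge] step.prems by simp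
  next
    case 3
    then show ?thesis using step by simp
  next
    case 4
    show ?thesis
    proof (cases "1 \<le> lookup m (Q j')")
      case True
      then obtain m' where m: "m = m' + unit_exp (Q j')" by (rule exp_split)
      have "(m' + unit_exp (Q i)) + unit_exp (P j) + unit_exp (Q j') \<in> N"
        using step.prems(2) by (simp add: m ac_simps)
      then have "(m' + unit_exp (Q i)) + unit_exp (P j') + unit_exp (Q j) \<in> N"
        by (rule swap[OF edge])
      moreover have "(m' + unit_exp (Q i)) + unit_exp (P j') + unit_exp (Q j)
          = (m' + unit_exp (Q j)) + unit_exp (P j') + unit_exp (Q i)" by (simp add: ac_simps)
      moreover have "T \<subseteq> vsupp ((m' + unit_exp (Q j)) + unit_exp (P j') + unit_exp (Q i))"
      proof -
        have "vsupp (m + unit_exp (P j) + unit_exp (Q i))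
            = vsupp ((m' + unit_exp (Q j)) + unit_exp (P j') + unit_exp (Q i))"
          using assms(2) unfolding m vsupp_def vdeg_def sides_def
          by (auto simp: lookup_add lookup_single when_def)
        then show ?thesis using step.prems(1) by simp
      qed
      ultimately have "(m' + unit_exp (Q j)) + unit_exp (P i) + unit_exp (Q j') \<in> N"
        using step.IH by simp
      then show ?thesis by (simp add: m ac_simps)
    next
      case False
      have "j' \<in> vsupp m" using j' 4 step.prems(1) by (auto simp: vsupp_sides[OF assms(2)])
      with False have "1 \<le> lookup m (P j')" by (simp add: vsupp_def vdeg_sides[OF assms(2)])
      then obtain m' where m: "m = m' + unit_exp (P j')" by (rule exp_split)
      have eq: "m + unit_exp (P j) + unit_exp (Q i)
          = (m' + unit_exp (P j)) + unit_exp (P j') + unit_exp (Q i)" by (simp add: m ac_simps)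
      have "(m' + unit_exp (P j)) + unit_exp (P i) + unit_exp (Q j') \<in> N"
        using step.IH step.prems unfolding eq by blast
      then have "(m' + unit_exp (P i)) + unit_exp (P j) + unit_exp (Q j') \<in> N"
        by (simp add: ac_simps)
      then have "(m' + unit_exp (P i)) + unit_exp (P j') + unit_exp (Q j) \<in> N"
        by (rule swap[OF edge])
      then show ?thesis by (simp add: m ac_simps)
    qed
  qed
qed

text \<open>Induction on the number of \<open>P\<close>-variables in \<open>C\<close> outside
  \<open>i\<close>: one of them is exchanged along a path for a \<open>Q\<close>-variable at
  \<open>i\<close>, which keeps the degree at \<open>i\<close> and the sum over \<open>C\<close>.
  When none is left, the sum is a single exponent, hence below \<open>k\<close>.\<close>

lemma component_side_bound:
  fixes N :: "('v::finite + 'v \<Rightarrow>\<^sub>0 nat) set"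
  assumes "swap_closed E N" "sides P Q" and bd: "\<And>w z. w \<in> N \<Longrightarrow> lookup w z < k"
    and C: "\<And>j. j \<in> C \<Longrightarrow> (step_in E T)\<^sup>*\<^sup>* j i" and "i \<in> C"
    and "w \<in> N" "T \<subseteq> vsupp w" "k \<le> vdeg w i"
  shows "(\<Sum>j\<in>C. lookup w (P j)) < k"
  using assms(6-8)
proof (induction "\<Sum>j\<in>C - {i}. lookup w (P j)" arbitrary: w)
  case 0
  have "(\<Sum>j\<in>C. lookup w (P j)) = lookup w (P i) + (\<Sum>j\<in>C - {i}. lookup w (P j))"
    by (rule sum.remove) (use \<open>i \<in> C\<close> in auto)
  then show ?case using 0 bd by simp
next
  case (Suc t)
  obtain j where j: "j \<in> C" "j \<noteq> i" "1 \<le> lookup w (P j)"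
    using Suc(2) sum.neutral[of "C - {i}" "\<lambda>j. lookup w (P j)"]
    by (metis Diff_iff One_nat_def Suc_leI insertI1 nat.distinct(1) not_gr_zero)
  then obtain m1 where m1: "w = m1 + unit_exp (P j)" by (meson exp_split)
  \<comment> \<open>The \<open>P\<close>-exponent at \<open>i\<close> is below \<open>k\<close> but
    the degree there is not, so \<open>i\<close> has a \<open>Q\<close>-variable to give
    away.\<close>
  have "1 \<le> lookup w (Q i)"
    using bd[OF \<open>w \<in> N\<close>, of "P i"] Suc(5) by (simp add: vdeg_sides[OF assms(2)])
  then have "1 \<le> lookup m1 (Q i)"
    using assms(2) by (auto simp: m1 sides_def lookup_add lookup_single when_def split: if_splits)
  then obtain m where "m1 = m + unit_exp (Q i)" by (meson exp_split)
  with m1 have w: "w = m + unit_exp (P j) + unit_exp (Q i)" by (simp add: ac_simps)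
  define w' where "w' = m + unit_exp (P i) + unit_exp (Q j)"
  have "w' \<in> N" unfolding w'_def
    by (rule swap_along_path[OF assms(1,2) C[OF j(1)]]) (use Suc w in auto)
  moreover have "T \<subseteq> vsupp w'"
    using Suc(4) unfolding w w'_def vsupp_sides[OF assms(2)] by auto
  moreover have "k \<le> vdeg w' i"
    using Suc(5) j(2) unfolding w w'_def vdeg_sides[OF assms(2)] lookup_sides[OF assms(2)] by simp
  moreover have "t = (\<Sum>l\<in>C - {i}. lookup w' (P l))"
  proof -
    have "(\<Sum>l\<in>C - {i}. lookup w (P l)) = (\<Sum>l\<in>C - {i}. lookup m (P l)) + 1"
      using j unfolding w lookup_sides[OF assms(2)] by (simp add: sum.distrib of_bool_def)
    moreover have "(\<Sum>l\<in>C - {i}. lookup w' (P l)) = (\<Sum>l\<in>C - {i}. lookup m (P l))"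
      unfolding w'_def lookup_sides[OF assms(2)] by (rule sum.cong) auto
    ultimately show ?thesis using Suc(2) by simp
  qed
  ultimately have "(\<Sum>l\<in>C. lookup w' (P l)) < k" using Suc(1) by blast
  moreover have "(\<Sum>l\<in>C. lookup w' (P l)) = (\<Sum>l\<in>C. lookup w (P l))"
    using j \<open>i \<in> C\<close> unfolding w w'_def lookup_sides[OF assms(2)]
    by (simp add: sum.distrib of_bool_def)
  ultimately show ?case by simp
qed

text \<open>
  A component containing a vertex of degree at least \<open>k\<close> carries at most \<open>k - 1\<close> variables of
  each kind, since all variables of one kind could be gathered at that vertex.
\<close>

lemma swap_closed_mdeg_le:
  fixes N :: "('v::finite + 'v \<Rightarrow>\<^sub>0 nat) set"
  assumes E: "simple_graph E" and N: "swap_closed E N"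
    and bd: "\<And>w z. w \<in> N \<Longrightarrow> lookup w z < k" and w: "w \<in> N"
  shows "mdeg w \<le> (k - 1) * weight E (vsupp w)"
proof -
  define T where "T = vsupp w"
  define R where "R = (step_in E T)\<^sup>*\<^sup>*"
  define comp where "comp i = {j\<in>T. R j i}" for i
  have symR: "R i j \<Longrightarrow> R j i" for i j
    unfolding R_def by (rule sympD[OF symp_rtranclp]) (auto intro: sympI simp: insert_commute)
  have transR: "R a b \<Longrightarrow> R b c \<Longrightarrow> R a c" for a b c unfolding R_def by simp
  have reflR: "R a a" for a unfolding R_def by simp
  have comp_eq: "{j\<in>T. comp j = comp i} = comp i" if "i \<in> T" for i
    using that symR transR reflR unfolding comp_def by blast
  let ?I = "isolated E T"
  have bound: "(\<Sum>j\<in>comp i. vdeg w j) \<le> (\<Sum>j\<in>comp i. (k - 1) * (1 + of_bool (j \<in> ?I)))"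
    if i: "i \<in> T" for i
  \<comment> \<open>If all non-isolated vertices of the component have degree below
    \<open>k\<close>, the bound holds vertex by vertex; an isolated vertex has two exponents of at
    most k - 1.\<close>
  proof (cases "\<exists>a\<in>comp i. a \<notin> ?I \<and> k \<le> vdeg w a")
    case False
    show ?thesis
    proof (rule sum_mono)
      fix j assume j: "j \<in> comp i"
      show "vdeg w j \<le> (k - 1) * (1 + of_bool (j \<in> ?I))"
      proof (cases "j \<in> ?I")
        case True
        then show ?thesis using bd[OF w, of "Inl j"] bd[OF w, of "Inr j"] by (simp add: vdeg_def)
      next
        case False
        then have "vdeg w j < k" using j \<open>\<not> (\<exists>a\<in>comp i. _ a)\<close> by force
        with False show ?thesis by simp
      qed
    qed
  next
    case True
    then obtain a where a: "a \<in> comp i" "a \<notin> ?I" "k \<le> vdeg w a" by blast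
    have ja: "(step_in E T)\<^sup>*\<^sup>* j a" if "j \<in> comp i" for j
      using that a symR transR unfolding comp_def R_def[symmetric] by blast
    have T: "T \<subseteq> vsupp w" by (simp add: T_def)
    have "(\<Sum>j\<in>comp i. lookup w (Inl j)) < k"
      by (rule component_side_bound[OF N _ bd ja a(1) w T a(3), of Inl Inr]) (simp_all add: sides_def)
    moreover have "(\<Sum>j\<in>comp i. lookup w (Inr j)) < k"
      by (rule component_side_bound[OF N _ bd ja a(1) w T a(3), of Inr Inl]) (simp_all add: sides_def)
    ultimately have "(\<Sum>j\<in>comp i. vdeg w j) \<le> (k - 1) * 2"
      by (simp add: vdeg_def sum.distrib)
    also have "\<dots> \<le> (k - 1) * (\<Sum>j\<in>comp i. 1 + of_bool (j \<in> ?I))"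
    proof (rule mult_le_mono2)
      \<comment> \<open>A neighbour of \<open>a\<close> is a second vertex of the component, so the
        right-hand side is at least 2 (k - 1).\<close>
      obtain b where b: "b \<in> T" "{a, b} \<in> E" using a unfolding isolated_def comp_def by blast
      have "R b a" unfolding R_def
        by (rule r_into_rtranclp) (use a b in \<open>auto simp: comp_def insert_commute\<close>)
      then have bc: "b \<in> comp i" using a b transR unfolding comp_def by blast
      have "2 = card {a, b}" using E b(2) by (simp add: simple_graph_def)
      also have "\<dots> \<le> card (comp i)" by (rule card_mono) (use a bc in auto)
      also have "\<dots> = (\<Sum>j\<in>comp i. 1)" by simp
      also have "\<dots> \<le> (\<Sum>j\<in>comp i. 1 + of_bool (j \<in> ?I))" by (rule sum_mono) simp
      finally show "(2::nat) \<le> (\<Sum>j\<in>comp i. 1 + of_bool (j \<in> ?I))" .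
    qed
    finally show ?thesis by (simp add: sum_distrib_left)
  qed
  have "mdeg w = (\<Sum>j\<in>T. vdeg w j)"
    unfolding mdeg_def T_def vsupp_def by (rule sum.mono_neutral_right) auto
  \<comment> \<open>The components of the subgraph induced on \<open>T\<close> are the fibres of
    \<open>comp\<close>.\<close>
  also have "\<dots> = (\<Sum>c\<in>comp ` T. \<Sum>j\<in>{j\<in>T. comp j = c}. vdeg w j)"
    by (rule sum.image_gen) simp
  also have "\<dots> \<le> (\<Sum>c\<in>comp ` T. \<Sum>j\<in>{j\<in>T. comp j = c}. (k - 1) * (1 + of_bool (j \<in> ?I)))"
    by (rule sum_mono) (auto simp only: comp_eq bound)
  also have "\<dots> = (\<Sum>j\<in>T. (k - 1) * (1 + of_bool (j \<in> ?I)))"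
    by (rule sum.image_gen[symmetric]) simp
  also have "\<dots> = (k - 1) * (\<Sum>j\<in>T. 1 + of_bool (j \<in> ?I))" by (simp add: sum_distrib_left)
  also have "(\<Sum>j\<in>T. 1 + of_bool (j \<in> ?I)) = weight E T"
  proof -
    have "T \<inter> ?I = ?I" by (auto simp: isolated_def)
    then show ?thesis by (simp add: weight_def sum.distrib)
  qed
  finally show ?thesis by (simp add: T_def)
qed

section \<open>The quotient by the bracket power and the binomial edge ideal\<close>

abbreviation BJ :: "nat \<Rightarrow> 'v set set \<Rightarrow> ('v, 'k::field) xy_poly set" where
  "BJ k E \<equiv> ideal_sum (bracket_power k) (binomial_edge_ideal E)"

lemma binomial_eq:
  "m + unit_exp (Inl i) + unit_exp (Inr j) = a \<Longrightarrow> m + unit_exp (Inl j) + unit_exp (Inr i) = b \<Longrightarrow>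
   Poly_Mapping.single m c * (var_x i * var_y j - var_x j * var_y i)
     = (Poly_Mapping.single a c - Poly_Mapping.single b c :: ('v, 'k::field) xy_poly)"
  by (auto simp: var_x_def var_y_def mult_single right_diff_distrib add.assoc)

lemma subspace_BJ: "module.subspace (*) (BJ k E :: ('v, 'k::field) xy_poly set)"
  unfolding bracket_power_def binomial_edge_ideal_def
  by (intro subspace_ideal_sum subspace_ideal_gen)

lemma monom1_in_BJ:
  assumes "k \<le> lookup m z"
  shows "monom1 m \<in> (BJ k E :: ('v, 'k::field) xy_poly set)"
proof -
  obtain m' where m: "m = m' + Poly_Mapping.single z k" using assms by (rule exp_split)
  have "monom1 (Poly_Mapping.single z k) \<in> (bracket_power k :: ('v, 'k) xy_poly set)"
    unfolding bracket_power_def var_x_power var_y_power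
    by (rule ideal_gen_base) (cases z; auto)
  then have "monom1 (Poly_Mapping.single z k) \<in> (BJ k E :: ('v, 'k) xy_poly set)"
    by (rule ideal_sum_left[rotated]) (simp add: binomial_edge_ideal_def subspace_ideal_gen)
  then have "monom1 m' * monom1 (Poly_Mapping.single z k) \<in> (BJ k E :: ('v, 'k) xy_poly set)"
    using subspace_BJ unfolding subspace_self_iff by blast
  then show ?thesis by (simp add: m mult_single)
qed

text \<open>The two monomials differ by a multiple of a generator of J_G, so they lie in the ideal
  together. Hence the degree bound for swap-closed sets applies to the monomials outside the
  ideal.\<close>

lemma swap_closed_not_in_BJ:
  "swap_closed E {m. monom1 m \<notin> (BJ k E :: ('v, 'k::field) xy_poly set)}"
  unfolding swap_closed_def
proof (intro allI impI, simp only: mem_Collect_eq, rule notI)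
  fix m :: "'v + 'v \<Rightarrow>\<^sub>0 nat" and i j
  let ?a = "m + unit_exp (Inl i) + unit_exp (Inr j)"
  let ?b = "m + unit_exp (Inl j) + unit_exp (Inr i)"
  assume e: "{i, j} \<in> E" and a: "monom1 ?a \<notin> (BJ k E :: ('v, 'k) xy_poly set)"
    and b: "monom1 ?b \<in> (BJ k E :: ('v, 'k) xy_poly set)"
  have "var_x i * var_y j - var_x j * var_y i \<in> (binomial_edge_ideal E :: ('v, 'k) xy_poly set)"
    unfolding binomial_edge_ideal_def by (rule ideal_gen_base) (use e in blast)
  then have "var_x i * var_y j - var_x j * var_y i \<in> (BJ k E :: ('v, 'k) xy_poly set)"
    by (rule ideal_sum_right[rotated]) (simp add: bracket_power_def subspace_ideal_gen)
  then have "monom1 m * (var_x i * var_y j - var_x j * var_y i) + monom1 ?b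
      \<in> (BJ k E :: ('v, 'k) xy_poly set)"
    using b subspace_BJ unfolding subspace_self_iff by blast
  with a show False by (simp add: binomial_eq[OF refl refl])
qed

text \<open>
  The sum of the coefficients over a swap-closed set of exponents is a linear form that
  vanishes on \<open>J\<^sub>G\<close>.
\<close>

lemma monom1_not_in_BJ:
  fixes W :: "('v + 'v \<Rightarrow>\<^sub>0 nat) set"
  assumes W: "swap_closed E W" and "finite W" and bd: "\<And>w z. w \<in> W \<Longrightarrow> lookup w z < k"
    and "u \<in> W"
  shows "monom1 u \<notin> (BJ k E :: ('v, 'k::field) xy_poly set)"
proof
  define \<phi> :: "('v, 'k) xy_poly \<Rightarrow> 'k" where "\<phi> p = (\<Sum>w\<in>W. lookup p w)" for p
  have add: "\<phi> (p + q) = \<phi> p + \<phi> q" for p q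
    by (simp add: \<phi>_def lookup_add sum.distrib)
  have single: "\<phi> (Poly_Mapping.single m c) = (if m \<in> W then c else 0)" for m c
    using \<open>finite W\<close> by (simp add: \<phi>_def lookup_single when_def)
  have diff: "\<phi> (p - q) = \<phi> p - \<phi> q" for p q
    by (simp add: \<phi>_def lookup_minus sum_subtractf)
  \<comment> \<open>The kernel of \<open>\<phi>\<close> need not be an ideal; \<open>Q\<close> is
    the largest ideal inside it. By linearity, monomial multiples suffice to test
    membership.\<close>
  define Q where "Q = {p. \<forall>s. \<phi> (s * p) = 0}"
  have Q: "module.subspace (*) Q" unfolding subspace_self_iff Q_def
    by (auto simp: add distrib_left mult.assoc[symmetric]) (simp add: \<phi>_def)
  have QI: "p \<in> Q" if "\<And>m c. \<phi> (Poly_Mapping.single m c * p) = 0" for p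
  proof -
    have "\<phi> (s * p) = 0" for s
    proof -
      have "\<phi> (\<Sum>m\<in>M. Poly_Mapping.single m (lookup s m) * p) = 0" for M
        by (induction M rule: infinite_finite_induct) (simp_all add: add that, simp_all add: \<phi>_def)
      from this[of "keys s"] show ?thesis
        by (simp add: sum_distrib_right[symmetric] sum_single_lookup)
    qed
    then show ?thesis by (simp add: Q_def)
  qed
  have "(binomial_edge_ideal E :: ('v, 'k) xy_poly set) \<subseteq> Q"
    unfolding binomial_edge_ideal_def
  proof (rule ideal_gen_least[OF _ Q], clarify)
    fix i j assume e: "{i, j} \<in> E"
    then have e': "{j, i} \<in> E" by (simp add: insert_commute)
    show "var_x i * var_y j - var_x j * var_y i \<in> Q"
    proof (rule QI)
      fix m c
      have "m + unit_exp (Inl i) + unit_exp (Inr j) \<in> W \<longleftrightarrow>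
            m + unit_exp (Inl j) + unit_exp (Inr i) \<in> W"
        using W e e' unfolding swap_closed_def by blast
      then show "\<phi> (Poly_Mapping.single m c * (var_x i * var_y j - var_x j * var_y i)) = 0"
        unfolding binomial_eq[OF refl refl] diff single by simp
    qed
  qed
  moreover have "(bracket_power k :: ('v, 'k) xy_poly set) \<subseteq> Q"
  proof -
    have "monom1 (Poly_Mapping.single z k) \<in> Q" for z
    proof (rule QI)
      fix m c
      have "m + Poly_Mapping.single z k \<notin> W"
        using bd[of "m + Poly_Mapping.single z k" z] by (auto simp: lookup_add)
      then show "\<phi> (Poly_Mapping.single m c * monom1 (Poly_Mapping.single z k)) = 0"
        by (simp add: mult_single single)
    qed
    then show ?thesis unfolding bracket_power_def var_x_power var_y_power
      by (intro ideal_gen_least[OF _ Q]) auto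
  qed
  moreover assume "monom1 u \<in> (BJ k E :: ('v, 'k) xy_poly set)"
  ultimately have "monom1 u \<in> Q" using ideal_sum_least[OF Q] by blast
  then have "\<phi> (1 * monom1 u) = 0" unfolding Q_def by blast
  then show False using \<open>u \<in> W\<close> by (simp add: single)
qed

lemma finite_bounded_exps: "finite {w :: 'z::finite \<Rightarrow>\<^sub>0 nat. \<forall>z. lookup w z < k}"
proof (rule finite_imageD)
  have "lookup ` {w :: 'z \<Rightarrow>\<^sub>0 nat. \<forall>z. lookup w z < k} \<subseteq> (\<Pi>\<^sub>E z\<in>UNIV. {..<k})"
    by (auto simp: PiE_def)
  then show "finite (lookup ` {w :: 'z \<Rightarrow>\<^sub>0 nat. \<forall>z. lookup w z < k})"
    by (rule finite_subset) (intro finite_PiE; simp)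
  show "inj_on lookup {w :: 'z \<Rightarrow>\<^sub>0 nat. \<forall>z. lookup w z < k}"
    by (auto intro: inj_onI poly_mapping_eqI)
qed

text \<open>
  The witness is \<open>(x\<^sub>i y\<^sub>i)\<^sup>k\<^sup>-\<^sup>1\<close> at the isolated and \<open>x\<^sub>i\<^sup>k\<^sup>-\<^sup>1\<close> at the other vertices of the
  subgraph induced on \<open>T\<close>.
\<close>

lemma max_ideal_power_not_subset:
  fixes T :: "'v::finite set"
  assumes "1 \<le> k"
  shows "\<not> ideal_power max_ideal ((k - 1) * weight E T) \<subseteq> (BJ k E :: ('v, 'k::field) xy_poly set)"
proof -
  let ?I = "isolated E T"
  \<comment> \<open>All monomials with the vertex degrees of the witness \<open>u\<close> and
    exponents below \<open>k\<close>.\<close>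
  define W where "W = {w :: 'v + 'v \<Rightarrow>\<^sub>0 nat. \<forall>i. lookup w (Inl i) < k \<and> lookup w (Inr i) < k \<and>
      vdeg w i = (k - 1) * (of_bool (i \<in> T) + of_bool (i \<in> ?I))}"
  define u where "u = (\<Sum>i\<in>T. Poly_Mapping.single (Inl i :: 'v + 'v) (k - 1))
      + (\<Sum>i\<in>?I. Poly_Mapping.single (Inr i) (k - 1))"
  have lu: "lookup u (Inl i) = (if i \<in> T then k - 1 else 0)"
    "lookup u (Inr i) = (if i \<in> ?I then k - 1 else 0)" for i
    unfolding u_def by (simp_all add: lookup_add lookup_sum lookup_single when_def)
  have "u \<in> W" using assms by (auto simp: W_def lu vdeg_def)
  have "swap_closed E W" unfolding swap_closed_def
  proof (intro allI impI)
    fix m :: "'v + 'v \<Rightarrow>\<^sub>0 nat" and i j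
    let ?a = "m + unit_exp (Inl i) + unit_exp (Inr j)"
    let ?b = "m + unit_exp (Inl j) + unit_exp (Inr i)"
    assume e: "{i, j} \<in> E" and a: "?a \<in> W"
    have vd: "vdeg ?b l = vdeg ?a l" for l
      by (auto simp: vdeg_def lookup_add lookup_single when_def)
    have "0 < vdeg ?a i" "0 < vdeg ?a j" by (simp_all add: vdeg_def lookup_add)
    then have T: "i \<in> T" "j \<in> T" using a by (auto simp: W_def isolated_def split: if_splits)
    have nI: "i \<notin> ?I" "j \<notin> ?I" using e T by (auto simp: isolated_def insert_commute)
    \<comment> \<open>Only non-isolated vertices of \<open>T\<close> take part in a swap; their
      degree is k - 1, so no exponent there can reach \<open>k\<close>.\<close>
    have lt: "lookup ?b (Inl l) < k \<and> lookup ?b (Inr l) < k" for l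
    proof (cases "l = i \<or> l = j")
      case True
      then have "vdeg ?b l = k - 1" using a T nI unfolding vd by (auto simp: W_def)
      then show ?thesis using assms unfolding vdeg_def by linarith
    next
      case False
      then have "lookup ?b (Inl l) = lookup ?a (Inl l)" "lookup ?b (Inr l) = lookup ?a (Inr l)"
        by (auto simp: lookup_add lookup_single when_def)
      with a show ?thesis by (simp add: W_def)
    qed
    with a vd show "?b \<in> W" unfolding W_def by simp
  qed
  moreover have lt: "lookup w z < k" if "w \<in> W" for w z using that by (cases z) (auto simp: W_def)
  moreover have "finite W"
    by (rule finite_subset[OF _ finite_bounded_exps[of k]]) (use lt in blast)
  ultimately have "monom1 u \<notin> (BJ k E :: ('v, 'k) xy_poly set)"
    using \<open>u \<in> W\<close> by (intro monom1_not_in_BJ)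
  moreover have "mdeg u = (k - 1) * weight E T"
  proof -
    have "mdeg u = (\<Sum>i\<in>UNIV. (k - 1) * (of_bool (i \<in> T) + of_bool (i \<in> ?I)))"
      unfolding mdeg_def using \<open>u \<in> W\<close> by (simp add: W_def)
    also have "\<dots> = (k - 1) * (\<Sum>i\<in>UNIV. of_bool (i \<in> T) + of_bool (i \<in> ?I))"
      by (simp only: sum_distrib_left)
    finally show ?thesis by (simp add: weight_def sum.distrib)
  qed
  ultimately show ?thesis using monom1_in_max_ideal_power[of u] by auto
qed

text \<open>A monomial outside the ideal has degree at most k - 1 times the weight of its support,
  which is less than \<open>r\<close>.\<close>

lemma max_ideal_power_subset:
  assumes "simple_graph E"
    and "\<And>T :: 'v::finite set. (k - 1) * weight E T < r"
  shows "ideal_power max_ideal r \<subseteq> (BJ k E :: ('v, 'k::field) xy_poly set)"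
proof
  fix p :: "('v, 'k) xy_poly" assume p: "p \<in> ideal_power max_ideal r"
  show "p \<in> BJ k E"
  proof (rule poly_in_ideal_if_monomials[OF subspace_BJ], rule ccontr)
    fix m assume m: "m \<in> keys p" and "monom1 m \<notin> (BJ k E :: ('v, 'k) xy_poly set)"
    then have "mdeg m \<le> (k - 1) * weight E (vsupp m)"
      by (intro swap_closed_mdeg_le[OF assms(1) swap_closed_not_in_BJ[where 'k='k]])
         (auto simp: not_le[symmetric] intro: monom1_in_BJ)
    moreover have "r \<le> mdeg m" using p m max_ideal_power_mdeg by blast
    ultimately show False using assms(2)[of "vsupp m"] by simp
  qed
qed

section \<open>The value of v_G(k) and its growth\<close>

definition max_weight :: "'v::finite set set \<Rightarrow> nat" where
  "max_weight E = Max (range (weight E))"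

lemma v_func_eq:
  fixes E :: "'v::finite set set"
  assumes "simple_graph E" and "1 \<le> k"
  shows "v_func TYPE('k::field) E k = (k - 1) * max_weight E"
proof -
  have le: "weight E T \<le> max_weight E" for T
    unfolding max_weight_def by (rule Max_ge) auto
  have "max_weight E \<in> range (weight E)" unfolding max_weight_def by (rule Max_in) auto
  then obtain T where T: "max_weight E = weight E T" by blast
  let ?R = "{r. \<not> ideal_power max_ideal r \<subseteq> (BJ k E :: ('v, 'k) xy_poly set)}"
  have ub: "r \<le> (k - 1) * max_weight E" if "r \<in> ?R" for r
  proof (rule ccontr)
    assume "\<not> ?thesis"
    then have "(k - 1) * weight E S < r" for S
      using mult_le_mono2[OF le[of S], of "k - 1"] by linarith
    with that max_ideal_power_subset[OF assms(1)] show False by blast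
  qed
  show ?thesis unfolding v_func_def
  proof (rule Max_eqI)
    \<comment> \<open>\<open>Max\<close> is meaningful on finite sets only; finiteness comes from
      the upper bound.\<close>
    show "finite ?R" by (rule finite_subset[of _ "{..(k - 1) * max_weight E}"]) (use ub in auto)
    show "(k - 1) * max_weight E \<in> ?R"
      unfolding T using max_ideal_power_not_subset[OF assms(2)] by blast
  qed (rule ub)
qed

lemma v_func_tendsto:
  fixes E :: "'v::finite set set"
  assumes "simple_graph E"
  shows "(\<lambda>k. real (v_func TYPE('k::field) E k) / real k) \<longlonglongrightarrow> real (max_weight E)"
proof -
  \<comment> \<open>For k \<ge> 1, (k - 1) M / k equals M - M / k.\<close>
  have "(\<lambda>k. real (max_weight E) - real (max_weight E) / real k) \<longlonglongrightarrow> real (max_weight E) - 0"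
    by (intro tendsto_diff tendsto_const lim_const_over_n)
  moreover have "eventually (\<lambda>k. real (max_weight E) - real (max_weight E) / real k
      = real (v_func TYPE('k) E k) / real k) sequentially"
    using eventually_ge_at_top[of 1]
    by eventually_elim (simp add: v_func_eq[OF assms] of_nat_diff field_simps)
  ultimately show ?thesis by (simp add: tendsto_cong)
qed

section \<open>Weights and CI-matchings\<close>

lemma CI_matching_weight_ge:
  fixes E :: "'v::finite set set"
  assumes "simple_graph E" "CI_matching E A B"
  shows "2 * card A + card (\<Union>B) \<le> weight E (A \<union> \<Union>B)"
proof -
  \<comment> \<open>A common vertex would have a neighbour in its clique, giving an edge between
    \<open>A\<close> and V(B).\<close>
  have "A \<inter> \<Union>B = {}"
  proof (rule ccontr)
    assume "\<not> ?thesis"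
    then obtain i C where i: "i \<in> A" "i \<in> C" "C \<in> B" by blast
    then have C: "clique E C" "card C \<ge> 2" using assms(2) unfolding CI_matching_def by auto
    have "C \<noteq> {i}" using C(2) by auto
    then obtain j where "j \<in> C" "i \<noteq> j" using i by blast
    with i C assms(2) show False unfolding CI_matching_def clique_def by blast
  qed
  then have "card (A \<union> \<Union>B) = card A + card (\<Union>B)" by (simp add: card_Un_disjoint)
  moreover have "card A \<le> card (isolated E (A \<union> \<Union>B))"
    using assms(2) by (intro card_mono)
      (auto simp: isolated_def CI_matching_def independent_set_def)
  ultimately show ?thesis by (simp add: weight_def)
qed

text \<open>
  If a clique meets \<open>T\<close> in an isolated vertex, then it meets \<open>T\<close> in this vertex only.
\<close>

lemma clique_weight_le:
  fixes C :: "'v::finite set"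
  assumes "clique E C" "2 \<le> card C"
  shows "card (C \<inter> T) + card (C \<inter> isolated E T) \<le> card C"
proof (cases "C \<inter> isolated E T = {}")
  case True
  then show ?thesis by (simp add: card_mono)
next
  case False
  then obtain i where i: "i \<in> C" "i \<in> isolated E T" by blast
  have "j = i" if "j \<in> C" "j \<in> T" for j
    using that i assms(1) unfolding isolated_def clique_def
    by (metis (no_types, lifting) mem_Collect_eq)
  then have "C \<inter> T \<subseteq> {i}" "C \<inter> isolated E T \<subseteq> {i}"
    by (auto simp: isolated_def)
  then have "card (C \<inter> T) \<le> card {i}" "card (C \<inter> isolated E T) \<le> card {i}"
    by (meson card_mono finite)+
  with assms(2) show ?thesis by simp
qed

text \<open>A vertex outside V(B) adds at most 2 to the weight, and a clique C of \<open>B\<close>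
  at most |C| by \<open>clique_weight_le\<close>; the total is at most 2 (n - b) + b with b =
  |V(B)|.\<close>

lemma CI_matching_weight_le:
  fixes E :: "'v::finite set set"
  assumes "CI_matching E A B"
  shows "weight E T + card (\<Union>B) \<le> 2 * CARD('v)"
proof -
  let ?I = "isolated E T"
  have disj: "\<forall>C\<in>B. \<forall>D\<in>B. C \<noteq> D \<longrightarrow> C \<inter> D = {}"
    using assms unfolding CI_matching_def disjoint_def by blast
  have card_UB: "card (\<Union>B \<inter> S) = (\<Sum>C\<in>B. card (C \<inter> S))" for S
  proof -
    have "card (\<Union>C\<in>B. C \<inter> S) = (\<Sum>C\<in>B. card (C \<inter> S))"
      by (rule card_UN_disjoint) (use disj in \<open>simp, simp, blast\<close>)
    then show ?thesis by (simp add: Int_commute)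
  qed
  have split: "card S \<le> card (\<Union>B \<inter> S) + (CARD('v) - card (\<Union>B))" for S
  proof -
    have "card S \<le> card ((\<Union>B \<inter> S) \<union> (- \<Union>B))" by (rule card_mono) auto
    also have "\<dots> \<le> card (\<Union>B \<inter> S) + card (- \<Union>B)" by (rule card_Un_le)
    finally show ?thesis by (simp add: Compl_eq_Diff_UNIV card_Diff_subset)
  qed
  have "card (\<Union>B \<inter> T) + card (\<Union>B \<inter> ?I) = (\<Sum>C\<in>B. card (C \<inter> T) + card (C \<inter> ?I))"
    by (simp only: card_UB sum.distrib)
  also have "\<dots> \<le> (\<Sum>C\<in>B. card C)"
    by (intro sum_mono clique_weight_le) (use assms in \<open>simp_all add: CI_matching_def\<close>)
  also have "\<dots> = card (\<Union>B)" using card_UB[of UNIV] by simp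
  finally have "card (\<Union>B \<inter> T) + card (\<Union>B \<inter> ?I) \<le> card (\<Union>B)" .
  moreover have "card (\<Union>B) \<le> CARD('v)" by (rule card_mono) auto
  ultimately show ?thesis using split[of T] split[of ?I] by (simp add: weight_def)
qed

theorem proposition4p2:
  fixes E :: "'v::finite set set" and A :: "'v set" and B :: "'v set set"
  assumes "simple_graph E"
    and "CI_matching E A B"
  shows "convergent (\<lambda>k. real (v_func TYPE('k::field) E k) / real k)
    \<and> 2 * real (card A) + real (card (\<Union>B)) \<le> F_threshold TYPE('k) E
    \<and> F_threshold TYPE('k) E \<le> 2 * real CARD('v) - real (card (\<Union>B))"
proof -
  note lim = v_func_tendsto[OF assms(1), where 'k='k]
  \<comment> \<open>The limit operator has a determined value only for a convergent sequence, so the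
    convergence just noted is what identifies it.\<close>
  have F: "F_threshold TYPE('k) E = real (max_weight E)"
    unfolding F_threshold_def using lim by (rule limI)
  have "weight E (A \<union> \<Union>B) \<le> max_weight E"
    unfolding max_weight_def by (rule Max_ge) auto
  then have lower: "2 * card A + card (\<Union>B) \<le> max_weight E"
    using CI_matching_weight_ge[OF assms] by simp
  have "max_weight E \<in> range (weight E)" unfolding max_weight_def by (rule Max_in) auto
  then have upper: "max_weight E + card (\<Union>B) \<le> 2 * CARD('v)"
    using CI_matching_weight_le[OF assms(2)] by auto
  have "2 * real (card A) + real (card (\<Union>B)) \<le> real (max_weight E)"
    using of_nat_mono[OF lower, where 'a=real] by simp
  moreover have "real (max_weight E) \<le> 2 * real CARD('v) - real (card (\<Union>B))"
    using of_nat_mono[OF upper, where 'a=real] by simp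
  ultimately show ?thesis using lim F by (auto intro: convergentI)
qed

end
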